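(* The family $\mathcal{H}_2=\{A\subseteq\omega : \text{there is no infinite } B\subseteq\omega \text{ with } \mathrm{FS}_2(B)\subseteq A\}$ is a $\mathbf{\Pi}_1^1$-complete subset of $\mathcal{P}(\omega)$.
   Context: $\omega=\{0,1,2,\dots\}$. $\mathcal{P}(\omega)$ is identified with the Cantor space $2^\omega$ via characteristic functions, and so is a Polish space. For an infinite $B\subseteq\omega$ put $\mathrm{FS}_2(B)=\{\sum_{n\in F}n : F\subseteq B,\ |F|=2\}$, the set of sums of two distinct elements of $B$. Completeness: for Polish spaces $\mathcal{X},\mathcal{Y}$ and $A\subseteq\mathcal{X}$, $B\subseteq\mathcal{Y}$, $B$ is Borel reducible to $A$ if there is a Borel function $f:\mathcal{Y}\to\mathcal{X}$ with $f^{-1}[A]=B$. $A\subseteq\mathcal{X}$ is $\mathbf{\Sigma}_1^1$-complete if $A$ is analytic and for every Polish space $\mathcal{Y}$ every analytic $B\subseteq\mathcal{Y}$ is Borel reducible to $A$. $A\subseteq\mathcal{X}$ is $\mathbf{\Pi}_1^1$-complete if $\mathcal{X}\setminus A$ is $\mathbf{\Sigma}_1^1$-complete. *)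

theory Defs
  imports "HOL-Analysis.Analysis"
begin

definition Polish_space :: "'a topology \<Rightarrow> bool" where
  "Polish_space X \<longleftrightarrow> completely_metrizable_space X \<and> separable_space X"

definition borel_of :: "'a topology \<Rightarrow> 'a measure" where
  "borel_of X = sigma (topspace X) {U. openin X U}"

text \<open>Analytic sets are the continuous images of Polish spaces. HOL cannot quantify over types
  inside a definition, so the witness is a Polish topology whose points are (some, not necessarily
  all) elements of \<^typ>\<open>nat \<Rightarrow> nat\<close>; it need not be the usual topology. This loses nothing:
  a Polish space has at most continuum many points, so it is homeomorphic to such a space.
  The empty space is included, so the empty set is analytic.\<close>

definition analytic_in :: "'a topology \<Rightarrow> 'a set \<Rightarrow> bool" where
  "analytic_in X A \<longleftrightarrow>
    (\<exists>(Z :: (nat \<Rightarrow> nat) topology) g.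
       Polish_space Z \<and> continuous_map Z X g \<and> g ` topspace Z = A)"

definition Borel_reducible :: "'b topology \<Rightarrow> 'b set \<Rightarrow> 'a topology \<Rightarrow> 'a set \<Rightarrow> bool" where
  "Borel_reducible Y B X A \<longleftrightarrow>
    (\<exists>f \<in> borel_of Y \<rightarrow>\<^sub>M borel_of X. {y \<in> topspace Y. f y \<in> A} = B)"

text \<open>The first argument only names the type of the points of the Polish spaces \<open>Y\<close>
  that are tested. A theorem in which this type is a free type variable speaks about
  Polish spaces with points of any type.\<close>

definition Sigma11_complete :: "'b itself \<Rightarrow> 'a topology \<Rightarrow> 'a set \<Rightarrow> bool" where
  "Sigma11_complete (_ :: 'b itself) X A \<longleftrightarrow>
    Polish_space X \<and> analytic_in X A \<and>
    (\<forall>(Y :: 'b topology) B. Polish_space Y \<and> analytic_in Y B \<longrightarrow> Borel_reducible Y B X A)"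

definition Pi11_complete :: "'b itself \<Rightarrow> 'a topology \<Rightarrow> 'a set \<Rightarrow> bool" where
  "Pi11_complete (T :: 'b itself) X A \<longleftrightarrow>
    A \<subseteq> topspace X \<and> Sigma11_complete T X (topspace X - A)"

text \<open>The topology on the power set of \<open>\<omega>\<close> that makes the map sending a set to its
  characteristic function a homeomorphism onto the Cantor space.\<close>

definition powerset_topology :: "nat set topology" where
  "powerset_topology =
    pullback_topology UNIV (\<lambda>A n. n \<in> A)
      (product_topology (\<lambda>_. discrete_topology (UNIV :: bool set)) (UNIV :: nat set))"

definition FS2 :: "nat set \<Rightarrow> nat set" where
  "FS2 B = {\<Sum>n\<in>F. n | F. F \<subseteq> B \<and> card F = 2}"

definition H2 :: "nat set set" where
  "H2 = {A. \<nexists>B. infinite B \<and> FS2 B \<subseteq> A}"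

end

theory Submission
  imports Defs
begin

text \<open>
  The complement of \<^const>\<open>H2\<close> is the projection of the closed set of pairs of a set \<open>A\<close> and
  a strictly increasing sequence all of whose pairwise sums lie in \<open>A\<close>, so it is analytic.

  For hardness, code a graph \<open>R\<close> on the naturals by the set of all \<open>4\<^sup>m + 4\<^sup>n\<close> with \<open>m < n\<close>
  adjacent. If \<open>B\<close> is infinite and its pairwise sums lie in this set, then all elements of \<open>B\<close>
  in some infinite subset are themselves powers of 4, so the coded set contains all pairwise sums
  of an infinite set if and only if \<open>R\<close> has an infinite clique. Now let an analytic set be given
  as the image of a complete separable metric space under a continuous map \<open>g\<close>, and fix a point
  \<open>y\<close>. The vertices are the balls with centre in a countable dense set and radius a power of 1/2;
  two balls of different radius are adjacent if the distance of their centres is less than the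
  sum of the radii and \<open>y\<close> is in the closure of the \<open>g\<close>-image of both. The centres of an infinite
  clique converge to a point that \<open>g\<close> maps to \<open>y\<close>, and conversely each preimage of \<open>y\<close> gives a
  clique of balls around it. Adjacency depends on \<open>y\<close> only through membership in countably many
  closed sets, so the reduction is Borel.
\<close>

section \<open>Polish topologies on sequences and on the power set\<close>

lemma second_countable_euclidean: "second_countable (euclidean :: 'a::second_countable_topology topology)"
proof -
  obtain B :: "'a set set" where "countable B" and B: "topological_basis B"
    using ex_countable_basis by blast
  show ?thesis
    unfolding second_countable_def
  proof (intro exI conjI ballI allI impI)
    show "openin euclidean V" if "V \<in> B" for V
      using topological_basis_open[OF B that] by simp
    show "\<exists>V\<in>B. x \<in> V \<and> V \<subseteq> U" if "openin euclidean U \<and> x \<in> U" for U x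
      using topological_basisE[OF B, of U x] that by (metis open_openin)
  qed fact
qed

lemma euclidean_eq_discrete_topology:
  "(euclidean :: 'a::discrete_topology topology) = discrete_topology UNIV"
  by (simp add: topology_eq open_discrete flip: open_openin)

text \<open>Supplies the Polish witness needed for \<open>analytic_in\<close>: complete
  metrizability comes from a countable product of discrete spaces and passes to closed subsets, and
  separability comes from second countability.\<close>

lemma Polish_space_closed_Baire:
  fixes S :: "(nat \<Rightarrow> nat) set"
  assumes "closed S"
  shows "Polish_space (top_of_set S)"
proof -
  have "completely_metrizable_space (product_topology (\<lambda>_. discrete_topology UNIV) UNIV :: (nat \<Rightarrow> nat) topology)"
    by (simp add: completely_metrizable_space_product_topology completely_metrizable_space_discrete_topology)
  then have "completely_metrizable_space (euclidean :: (nat \<Rightarrow> nat) topology)"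
    by (simp add: euclidean_eq_discrete_topology flip: euclidean_product_topology)
  then show ?thesis
    unfolding Polish_space_def
    using assms completely_metrizable_space_closedin closed_closedin
      second_countable_imp_separable_space second_countable_subtopology second_countable_euclidean
    by blast
qed

lemma topspace_powerset_topology [simp]: "topspace powerset_topology = UNIV"
  by (simp add: powerset_topology_def topspace_pullback_topology)

lemma continuous_map_powerset_topology:
  fixes g :: "'a \<Rightarrow> nat set"
  assumes "\<And>n. openin X {x \<in> topspace X. n \<in> g x}" "\<And>n. openin X {x \<in> topspace X. n \<notin> g x}"
  shows "continuous_map X powerset_topology g"
  unfolding powerset_topology_def
proof (rule continuous_map_pullback')
  have "openin X {x \<in> topspace X. (n \<in> g x) \<in> U}" for n U
  proof -
    have "{x \<in> topspace X. (n \<in> g x) \<in> U} =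
      (\<Union>b\<in>U. if b then {x \<in> topspace X. n \<in> g x} else {x \<in> topspace X. n \<notin> g x})"
      by (auto split: if_splits)
    moreover have "openin X \<dots>"
      using assms by (intro openin_Union) (auto split: if_splits)
    ultimately show ?thesis by simp
  qed
  then show "continuous_map X (product_topology (\<lambda>_. discrete_topology UNIV) UNIV) ((\<lambda>A n. n \<in> A) \<circ> g)"
    unfolding continuous_map_componentwise_UNIV by (simp add: continuous_map_def)
qed auto

lemma openin_powerset_topology_cylinder:
  assumes "openin powerset_topology U" "A \<in> U"
  obtains n where "{A'. A' \<inter> {..<n} = A \<inter> {..<n}} \<subseteq> U"
proof -
  obtain V where V: "openin (product_topology (\<lambda>_. discrete_topology (UNIV :: bool set)) (UNIV :: nat set)) V"
    and U: "U = (\<lambda>A n. n \<in> A) -` V"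
    using assms(1) by (auto simp: powerset_topology_def openin_pullback_topology)
  have "(\<lambda>n. n \<in> A) \<in> V" using assms(2) U by auto
  from product_topology_open_contains_basis[OF V this]
  obtain Q where Q: "\<And>i. (i \<in> A) \<in> Q i" "finite {i. Q i \<noteq> UNIV}" "Pi\<^sub>E UNIV Q \<subseteq> V"
    by (auto simp: PiE_iff)
  obtain n where n: "{i. Q i \<noteq> UNIV} \<subseteq> {..<n}"
    using finite_nat_iff_bounded Q(2) by metis
  show ?thesis
  proof
    show "{A'. A' \<inter> {..<n} = A \<inter> {..<n}} \<subseteq> U"
    proof
      fix A' assume "A' \<in> {A'. A' \<inter> {..<n} = A \<inter> {..<n}}"
      then have eq: "i \<in> A' \<longleftrightarrow> i \<in> A" if "i < n" for i using that by auto
      have "(i \<in> A') \<in> Q i" for i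
      proof (cases "i < n")
        case True then show ?thesis using eq Q(1)[of i] by simp
      next
        case False then have "Q i = UNIV" using n by auto
        then show ?thesis by simp
      qed
      then show "A' \<in> U" using Q(3) by (auto simp: U PiE_iff)
    qed
  qed
qed

lemma Polish_space_powerset_topology: "Polish_space powerset_topology"
proof -
  let ?P = "product_topology (\<lambda>_. discrete_topology (UNIV :: bool set)) (UNIV :: nat set)"
  have "continuous_map powerset_topology ?P (id \<circ> (\<lambda>A n. n \<in> A))"
    unfolding powerset_topology_def by (rule continuous_map_pullback) simp
  moreover have "continuous_map ?P powerset_topology Collect"
    unfolding powerset_topology_def by (rule continuous_map_pullback') (simp_all add: o_def)
  ultimately have "homeomorphic_maps powerset_topology ?P (\<lambda>A n. n \<in> A) Collect"
    by (simp add: homeomorphic_maps_def)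
  moreover have "completely_metrizable_space ?P"
    by (simp add: completely_metrizable_space_product_topology completely_metrizable_space_discrete_topology)
  ultimately have "completely_metrizable_space powerset_topology"
    using homeomorphic_completely_metrizable_space homeomorphic_space_def by blast
  \<comment> \<open>The finite sets form a countable dense set: the truncation of \<open>A\<close>
    below \<open>n\<close> lies in every cylinder around \<open>A\<close> of length
    \<open>n\<close>.\<close>
  moreover have "A \<in> powerset_topology closure_of Collect finite" for A
    unfolding in_closure_of
  proof (intro conjI allI impI)
    fix U assume "A \<in> U \<and> openin powerset_topology U"
    then obtain n where "{A'. A' \<inter> {..<n} = A \<inter> {..<n}} \<subseteq> U"
      using openin_powerset_topology_cylinder by blast
    then have "A \<inter> {..<n} \<in> U" by (rule subsetD) (simp add: Int_assoc)
    then show "\<exists>F. F \<in> Collect finite \<and> F \<in> U" by blast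
  qed simp
  then have "separable_space powerset_topology"
    unfolding separable_space_def
    by (intro exI[of _ "Collect finite"]) (auto simp: countable_Collect_finite)
  ultimately show ?thesis by (simp add: Polish_space_def)
qed

section \<open>The complement of \<open>H2\<close> is analytic\<close>

lemma open_coordinate:
  fixes T :: "'b::discrete_topology set"
  shows "open {z :: 'a \<Rightarrow> 'b. z n \<in> T}"
  using open_vimage[OF open_discrete[of T] continuous_on_product_coordinates[of n]] by (simp add: vimage_def)

lemma FS2I: "a \<in> B \<Longrightarrow> b \<in> B \<Longrightarrow> a \<noteq> b \<Longrightarrow> a + b \<in> FS2 B"
  unfolding FS2_def by (intro CollectI exI[of _ "{a, b}"]) auto

lemma FS2_eq: "FS2 B = {a + b | a b. a \<in> B \<and> b \<in> B \<and> a \<noteq> b}"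
proof
  show "FS2 B \<subseteq> {a + b | a b. a \<in> B \<and> b \<in> B \<and> a \<noteq> b}"
    unfolding FS2_def card_2_iff by fastforce
  show "{a + b | a b. a \<in> B \<and> b \<in> B \<and> a \<noteq> b} \<subseteq> FS2 B"
    using FS2I by blast
qed

lemma analytic_not_H2: "analytic_in powerset_topology (UNIV - H2)"
proof -
  \<comment> \<open>One sequence codes a pair: nonzero entries at even positions mark the elements
    of the set \<open>g z\<close>, and the odd positions list an increasing sequence. The factor 2
    in the inner index looks up whether the sum belongs to the set.\<close>
  define S where "S = {z :: nat \<Rightarrow> nat. \<forall>i j. i < j \<longrightarrow> z (2*i+1) < z (2*j+1) \<and> z (2 * (z (2*i+1) + z (2*j+1))) \<noteq> 0}"
  define g where "g = (\<lambda>z :: nat \<Rightarrow> nat. {n. z (2*n) \<noteq> 0})"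
  have "open {z :: nat \<Rightarrow> nat. \<not> (z i < z j \<and> z (2 * (z i + z j)) \<noteq> 0)}" for i j
  proof -
    \<comment> \<open>The position that is looked up depends on \<open>z\<close> itself. Fixing the
      values \<open>a\<close> and \<open>b\<close> makes it constant, which leaves a union of finite
      intersections of coordinate conditions.\<close>
    have "{z :: nat \<Rightarrow> nat. \<not> (z i < z j \<and> z (2 * (z i + z j)) \<noteq> 0)} =
      (\<Union>a b. {z. z i \<in> {a}} \<inter> {z. z j \<in> {b}} \<inter> {z. z (2 * (a + b)) \<in> (if a < b then {0} else UNIV)})"
      by auto
    also have "open \<dots>"
      by (intro open_UN ballI open_Int open_coordinate)
    finally show ?thesis .
  qed
  then have "closed {z :: nat \<Rightarrow> nat. z i < z j \<and> z (2 * (z i + z j)) \<noteq> 0}" for i j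
    by (simp only: closed_def Collect_neg_eq[symmetric])
  then have clS: "closed S"
    unfolding S_def by (intro closed_Collect_all closed_Collect_imp open_Collect_const)
  have "\<exists>B. infinite B \<and> FS2 B \<subseteq> g z" if z: "z \<in> S" for z
  proof (intro exI conjI)
    let ?B = "range (\<lambda>i. z (2*i+1))"
    have "strict_mono (\<lambda>i. z (2*i+1))"
      using z by (auto simp: S_def strict_mono_def)
    then show "infinite ?B"
      by (meson finite_imageD infinite_UNIV_nat strict_mono_imp_inj_on)
    have nonzero: "z (2 * (z (2*i+1) + z (2*j+1))) \<noteq> 0" if "i \<noteq> j" for i j
    proof -
      have *: "z (2 * (z (2*i+1) + z (2*j+1))) \<noteq> 0" if "i < j" for i j
        using z that by (simp add: S_def)
      from \<open>i \<noteq> j\<close> consider "i < j" | "j < i" by linarith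
      then show ?thesis
        by cases (use *[of i j] *[of j i] in \<open>simp_all add: add.commute\<close>)
    qed
    show "FS2 ?B \<subseteq> g z"
    proof
      fix n assume "n \<in> FS2 ?B"
      then obtain i j where ij: "n = z (2*i+1) + z (2*j+1)" "z (2*i+1) \<noteq> z (2*j+1)"
        unfolding FS2_eq by blast
      then have "i \<noteq> j" by blast
      then show "n \<in> g z" using nonzero ij(1) by (simp add: g_def)
    qed
  qed
  moreover have "\<exists>z\<in>S. g z = A" if "infinite B" "FS2 B \<subseteq> A" for A B
  proof
    define z where "z k = (if even k then of_bool (k div 2 \<in> A) else enumerate B (k div 2))" for k
    have z_even: "z (2*n) \<noteq> 0 \<longleftrightarrow> n \<in> A" and z_odd: "z (2*n+1) = enumerate B n" for n
      by (simp_all add: z_def)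
    show "g z = A" unfolding g_def z_even by simp
    have "enumerate B i + enumerate B j \<in> A" if "i < j" for i j
    proof -
      have "enumerate B i < enumerate B j"
        using that \<open>infinite B\<close> by (simp add: enumerate_mono)
      then have "enumerate B i \<noteq> enumerate B j" by simp
      then have "enumerate B i + enumerate B j \<in> FS2 B"
        using \<open>infinite B\<close> by (intro FS2I enumerate_in_set)
      then show ?thesis using \<open>FS2 B \<subseteq> A\<close> by blast
    qed
    then show "z \<in> S"
      unfolding S_def mem_Collect_eq z_even z_odd using \<open>infinite B\<close> by (simp add: enumerate_mono)
  qed
  ultimately have "g ` S = UNIV - H2"
    unfolding H2_def by blast
  moreover have "continuous_map (top_of_set S) powerset_topology g"
  proof (rule continuous_map_powerset_topology)
    fix n
    have "openin (top_of_set S) (S \<inter> {z. z (2*n) \<in> T})" for T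
      by (intro openin_open_Int open_coordinate)
    from this[of "-{0}"] this[of "{0}"]
    show "openin (top_of_set S) {z \<in> topspace (top_of_set S). n \<in> g z}"
      "openin (top_of_set S) {z \<in> topspace (top_of_set S). n \<notin> g z}"
      by (simp_all add: g_def Int_def)
  qed
  ultimately show ?thesis
    unfolding analytic_in_def using Polish_space_closed_Baire[OF clS]
    by (intro exI[of _ "top_of_set S"] exI[of _ g]) simp
qed

section \<open>Sums of two powers of 4 and infinite cliques\<close>

lemma four_pow_sum_inj:
  fixes m n k l :: nat
  assumes "4 ^ m + 4 ^ n = 4 ^ k + (4 ^ l :: nat)" "m < n" "k < l"
  shows "m = k \<and> n = l"
proof -
  have *: "n \<le> l" if "4 ^ m + 4 ^ n = 4 ^ k + (4 ^ l :: nat)" "m < n" "k < l" for m n k l :: nat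
  proof (rule ccontr)
    assume "\<not> n \<le> l"
    \<comment> \<open>The left sum would be at least \<open>4 * 4 ^ l\<close>, but the right sum is
      below \<open>2 * 4 ^ l\<close>.\<close>
    then have "(4::nat) ^ Suc l \<le> 4 ^ n" by (intro power_increasing) auto
    moreover have "(4::nat) ^ k < 4 ^ l" using that by simp
    ultimately show False using that(1) by simp
  qed
  have "n = l" using *[of m n k l] *[of k l m n] assms by simp
  then show ?thesis using assms(1) by simp
qed

text \<open>As \<open>c\<close> dominates \<open>a\<close> and \<open>b\<close>, the two sums differ
  by a factor below 7/6, whereas different leading exponents would force a factor above
  16/5.\<close>

lemma four_pow_sum_same_top:
  fixes m n k l a b c :: nat
  assumes "4 ^ m + 4 ^ n = c + (a::nat)" "4 ^ k + 4 ^ l = c + (b::nat)" "m < n" "k < l"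
    and "6 * a + 6 * b < c"
  shows "n = l"
proof -
  have *: "n \<le> l" if "4 ^ m + 4 ^ n = c + (a::nat)" "4 ^ k + 4 ^ l = c + (b::nat)" "m < n" "k < l" "6 * a + 6 * b < c"
    for m n k l a b :: nat
  proof (rule ccontr)
    assume "\<not> n \<le> l"
    then have "(4::nat) ^ Suc l \<le> 4 ^ n" by (intro power_increasing) auto
    moreover have "(4::nat) ^ Suc k \<le> 4 ^ l" using that by (intro power_increasing) auto
    ultimately show False using that by simp
  qed
  show ?thesis using *[of m n a k l b] *[of k l b m n a] assms by simp
qed

text \<open>Comparing the sums of a large \<open>c\<close> with two fixed elements
  \<open>b0 < b1\<close> bounds the lower exponent in \<open>c + b0\<close>, so by pigeonhole it is
  a constant \<open>m\<close> for infinitely many \<open>c\<close>. The sum of two such elements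
  then forces \<open>b0 = 4 ^ m\<close>, so each such \<open>c\<close> is a power of 4, and the
  exponents form the clique.\<close>

lemma ex_infinite_clique:
  fixes R :: "nat \<Rightarrow> nat \<Rightarrow> bool"
  assumes "infinite B" and FS2: "FS2 B \<subseteq> {4 ^ m + 4 ^ n | m n. m < n \<and> R m n}"
  obtains N where "infinite N" "\<And>m n. m \<in> N \<Longrightarrow> n \<in> N \<Longrightarrow> m < n \<Longrightarrow> R m n"
proof -
  have sum: "\<exists>m n. a + b = 4 ^ m + 4 ^ n \<and> m < n \<and> R m n" if "a \<in> B" "b \<in> B" "a < b" for a b
    using FS2I[of a B b] FS2 that by auto
  obtain b0 where b0: "b0 \<in> B"
    using \<open>infinite B\<close> by (metis finite.emptyI ex_in_conv)
  obtain b1 where b1: "b1 \<in> B" "b0 < b1"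
    using \<open>infinite B\<close> by (meson infinite_nat_iff_unbounded)
  define B' where "B' = {c \<in> B. 6 * b0 + 6 * b1 < c}"
  have "\<exists>p. c + b0 = 4 ^ fst p + 4 ^ snd p \<and> fst p < snd p \<and> fst p \<le> b1" if "c \<in> B'" for c
  proof -
    have c: "c \<in> B" "6 * b0 + 6 * b1 < c" using that by (auto simp: B'_def)
    obtain m n where mn: "b0 + c = 4 ^ m + 4 ^ n" "m < n"
      using sum[of b0 c] b0 c by auto
    obtain k l where kl: "b1 + c = 4 ^ k + 4 ^ l" "k < l"
      using sum[of b1 c] b1 c by auto
    have "n = l"
      using four_pow_sum_same_top[of m n c b0 k l b1] mn kl c by simp
    \<comment> \<open>Cancelling the common leading power leaves
      \<open>4 ^ k - 4 ^ m = b1 - b0\<close>. This is positive and at least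
      \<open>3 * 4 ^ m\<close>, which bounds \<open>m\<close> in terms of \<open>b1\<close>.\<close>
    with mn kl have *: "4 ^ k + b0 = 4 ^ m + b1" by simp
    then have "(4::nat) ^ m < 4 ^ k" using b1 by linarith
    then have "m < k" by simp
    then have "(4::nat) ^ Suc m \<le> 4 ^ k" by (intro power_increasing) auto
    then have "4 ^ m \<le> b1" using * by simp
    moreover have "m < 4 ^ m" by (rule power_gt_expt) simp
    ultimately have "m \<le> b1" by linarith
    then show ?thesis using mn by (intro exI[of _ "(m, n)"]) simp
  qed
  then obtain p where p: "\<And>c. c \<in> B' \<Longrightarrow> c + b0 = 4 ^ fst (p c) + 4 ^ snd (p c) \<and> fst (p c) < snd (p c) \<and> fst (p c) \<le> b1"
    by metis
  have "B \<subseteq> {..6 * b0 + 6 * b1} \<union> B'" by (auto simp: B'_def)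
  then have "infinite B'"
    using \<open>infinite B\<close> by (meson finite_UnI finite_atMost finite_subset)
  moreover have "finite ((\<lambda>c. fst (p c)) ` B')"
    by (rule finite_subset[of _ "{..b1}"]) (use p in auto)
  ultimately obtain c0 where "c0 \<in> B'" and inf: "infinite {c \<in> B'. fst (p c) = fst (p c0)}"
    using pigeonhole_infinite by blast
  define m where "m = fst (p c0)"
  define C where "C = {c \<in> B'. fst (p c) = m}"
  define g where "g c = snd (p c)" for c
  have "infinite C" using inf by (simp add: C_def m_def)
  have C: "c \<in> B" "c + b0 = 4 ^ m + 4 ^ g c" "m < g c" if "c \<in> C" for c
    using that p[of c] by (auto simp: C_def g_def B'_def)
  \<comment> \<open>The thresholds make \<open>c\<close> large against \<open>4 ^ m\<close> and
    \<open>b0\<close>, and \<open>c'\<close> large against \<open>c\<close>, so that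
    \<open>c + c'\<close> has the same leading power as \<open>c' + b0\<close>.\<close>
  obtain c where c: "c \<in> C" "16 * 4 ^ m + 16 * b0 < c"
    using \<open>infinite C\<close> by (meson infinite_nat_iff_unbounded)
  obtain c' where c': "c' \<in> C" "6 * b0 + 6 * c < c'"
    using \<open>infinite C\<close> by (meson infinite_nat_iff_unbounded)
  obtain k l where kl: "c + c' = 4 ^ k + 4 ^ l" "k < l"
    using sum[of c c'] c c' C by auto
  have "g c' = l"
    using four_pow_sum_same_top[of m "g c'" c' b0 k l c] C[OF c'(1)] kl c' by simp
  then have k: "4 ^ k + 2 * b0 = 2 * 4 ^ m + 4 ^ g c"
    using kl C(2)[OF c(1)] C(2)[OF c'(1)] by simp
  \<comment> \<open>The two powers in \<open>k\<close> differ by an amount that is small compared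
    with \<open>c\<close>, so they must coincide; what remains is
    \<open>2 * b0 = 2 * 4 ^ m\<close>.\<close>
  have "\<not> k < g c"
  proof
    assume "k < g c"
    then have "(4::nat) ^ Suc k \<le> 4 ^ g c" by (intro power_increasing) auto
    then show False using k C(2)[OF c(1)] c(2) by simp
  qed
  moreover have "\<not> g c < k"
  proof
    assume "g c < k"
    then have "(4::nat) ^ Suc (g c) \<le> 4 ^ k" by (intro power_increasing) auto
    then show False using k C(2)[OF c(1)] c(2) by simp
  qed
  ultimately have "b0 = 4 ^ m" using k by simp
  then have g: "4 ^ g c = c" if "c \<in> C" for c using C(2)[OF that] by simp
  show ?thesis
  proof
    have "inj_on g C" by (metis g inj_onI)
    then show "infinite (g ` C)" using \<open>infinite C\<close> finite_imageD by blast
    fix i j assume "i \<in> g ` C" "j \<in> g ` C" "i < j"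
    then obtain a b where ab: "a \<in> C" "b \<in> C" "i = g a" "j = g b" by blast
    have "(4::nat) ^ i < 4 ^ j" using \<open>i < j\<close> by simp
    then have "a < b" using g ab by simp
    then obtain k l where kl: "a + b = 4 ^ k + 4 ^ l" "k < l" "R k l" using sum C(1) ab by blast
    then have "4 ^ i + 4 ^ j = 4 ^ k + (4 ^ l :: nat)" using g ab by simp
    then show "R i j" using four_pow_sum_inj kl \<open>i < j\<close> by blast
  qed
qed

section \<open>Borel measurability of maps into the power set\<close>

lemma measurable_borel_of_powerset_topology:
  assumes "\<And>i. {y \<in> space M. i \<in> f y} \<in> sets M"
  shows "f \<in> M \<rightarrow>\<^sub>M borel_of powerset_topology"
  unfolding borel_of_def
proof (rule measurable_measure_of)
  fix U assume "U \<in> {U. openin powerset_topology U}"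
  then have U: "openin powerset_topology U" by simp
  have [measurable]: "Measurable.pred M (\<lambda>y. i \<in> f y)" for i
    using assms by (simp add: pred_def)
  \<comment> \<open>The patterns on the first \<open>n\<close> naturals whose cylinder lies inside
    \<open>U\<close>. There are finitely many for each \<open>n\<close>, so the preimage of
    \<open>U\<close> is a countable union of sets given by finitely many membership
    conditions.\<close>
  define S where "S n = {s \<in> Pow {..<n}. {A. A \<inter> {..<n} = s} \<subseteq> U}" for n
  have [simp]: "finite (S n)" for n by (simp add: S_def)
  have "f y \<in> U \<longleftrightarrow> (\<exists>n. \<exists>s\<in>S n. \<forall>i\<in>{..<n}. i \<in> f y \<longleftrightarrow> i \<in> s)" for y
  proof
    assume "f y \<in> U"
    then obtain n where "{A. A \<inter> {..<n} = f y \<inter> {..<n}} \<subseteq> U"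
      using openin_powerset_topology_cylinder[OF U] by blast
    then show "\<exists>n. \<exists>s\<in>S n. \<forall>i\<in>{..<n}. i \<in> f y \<longleftrightarrow> i \<in> s"
      by (intro exI[of _ n] bexI[of _ "f y \<inter> {..<n}"]) (auto simp: S_def)
  next
    assume "\<exists>n. \<exists>s\<in>S n. \<forall>i\<in>{..<n}. i \<in> f y \<longleftrightarrow> i \<in> s"
    then obtain n s where s: "s \<in> S n" "\<forall>i\<in>{..<n}. i \<in> f y \<longleftrightarrow> i \<in> s" by blast
    then have "f y \<inter> {..<n} = s" by (auto simp: S_def)
    then show "f y \<in> U" using s(1) by (auto simp: S_def)
  qed
  moreover have "Measurable.pred M (\<lambda>y. \<exists>n. \<exists>s\<in>S n. \<forall>i\<in>{..<n}. i \<in> f y \<longleftrightarrow> i \<in> s)"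
    by measurable
  ultimately have "{y \<in> space M. f y \<in> U} \<in> sets M" by (simp add: pred_def)
  moreover have "f -` U \<inter> space M = {y \<in> space M. f y \<in> U}" by auto
  ultimately show "f -` U \<inter> space M \<in> sets M" by simp
qed auto

lemma space_borel_of [simp]: "space (borel_of X) = topspace X"
  by (simp add: borel_of_def space_measure_of_conv)

lemma closedin_in_sets_borel_of:
  assumes "closedin X S"
  shows "S \<in> sets (borel_of X)"
proof -
  have "openin X (topspace X - S)" using assms by (simp add: closedin_def)
  then have "topspace X - S \<in> sets (borel_of X)"
    unfolding borel_of_def by (subst sets_measure_of) (auto dest: openin_subset)
  then have "topspace X - (topspace X - S) \<in> sets (borel_of X)"
    using sets.compl_sets by fastforce
  then show ?thesis using closedin_subset[OF assms] by (simp add: double_diff)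
qed

section \<open>Reducing an arbitrary analytic set to the complement of \<open>H2\<close>\<close>

lemma analytic_in_Borel_reducible_not_H2:
  fixes Y :: "'b topology"
  assumes "Polish_space Y" "analytic_in Y B"
  shows "Borel_reducible Y B powerset_topology (UNIV - H2)"
proof -
  obtain Z :: "(nat \<Rightarrow> nat) topology" and g where Z: "Polish_space Z"
    and g: "continuous_map Z Y g" "g ` topspace Z = B"
    using assms(2) unfolding analytic_in_def by blast
  obtain M d where "Metric_space M d" and "Metric_space.mcomplete M d" and Z_eq: "Z = Metric_space.mtopology M d"
    using Z unfolding Polish_space_def completely_metrizable_space_def by blast
  interpret Metric_space M d by fact
  obtain M' d' where "Metric_space M' d'" and Y_eq: "Y = Metric_space.mtopology M' d'"
    using assms(1) unfolding Polish_space_def completely_metrizable_space_def by blast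
  interpret Y: Metric_space M' d' by fact
  obtain D where D: "countable D" "D \<subseteq> M" "mtopology closure_of D = M"
    using Z unfolding Polish_space_def separable_space_def Z_eq by auto
  define e where "e n = snd (prod_decode n)" for n
  \<comment> \<open>A vertex codes a centre and the exponent of a radius. If \<open>D\<close> is
    empty, \<open>from_nat_into\<close> returns an arbitrary value, so a centre need not lie in
    \<open>M\<close>.\<close>
  define c where "c n = from_nat_into D (fst (prod_decode n))" for n
  define r where "r n = (1/2 :: real) ^ e n" for n
  \<comment> \<open>The closure makes the condition on \<open>y\<close> closed, hence Borel; the
    image of the ball itself is only analytic in general.\<close>
  define K where "K n = Y closure_of (g ` mball (c n) (r n))" for n
  \<comment> \<open>Requiring distinct exponents forces an infinite clique to contain arbitrarily
    small balls; the distance bound then makes their centres a Cauchy sequence.\<close>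
  define compat where "compat m n \<longleftrightarrow> e m \<noteq> e n \<and> d (c m) (c n) < r m + r n" for m n
  define R where "R y m n \<longleftrightarrow> compat m n \<and> y \<in> K m \<and> y \<in> K n" for y m n
  define f :: "'b \<Rightarrow> nat set" where "f y = {4 ^ m + 4 ^ n | m n. m < n \<and> R y m n}" for y
  have compat_sym: "compat m n \<longleftrightarrow> compat n m" for m n
    by (auto simp: compat_def commute)
  have "f \<in> borel_of Y \<rightarrow>\<^sub>M borel_of powerset_topology"
  proof (rule measurable_borel_of_powerset_topology)
    fix i
    have "{y \<in> space (borel_of Y). i \<in> f y} =
      (\<Union>m. \<Union>n\<in>{n. m < n \<and> compat m n \<and> i = 4 ^ m + 4 ^ n}. K m \<inter> K n)"
      using closure_of_subset_topspace[of Y] by (auto simp: f_def R_def K_def)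
    moreover have "K n \<in> sets (borel_of Y)" for n
      by (simp add: K_def closedin_in_sets_borel_of)
    ultimately show "{y \<in> space (borel_of Y). i \<in> f y} \<in> sets (borel_of Y)"
      by (auto intro!: sets.countable_UN')
  qed
  moreover have "f y \<notin> H2" if "y \<in> B" for y
  proof -
    obtain z where z: "z \<in> M" "y = g z" using \<open>y \<in> B\<close> g(2) Z_eq by auto
    have "\<exists>i. d z (from_nat_into D i) < (1/2) ^ k \<and> from_nat_into D i \<in> M" for k :: nat
    proof -
      have "z \<in> mtopology closure_of D" using z D by simp
      then obtain w where w: "w \<in> D" "d z w < (1/2) ^ k"
        unfolding metric_closure_of by (auto dest: spec[of _ "(1/2) ^ k"])
      moreover have "from_nat_into D (to_nat_on D w) = w" using w D by simp
      ultimately show ?thesis using D(2) by (intro exI[of _ "to_nat_on D w"]) auto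
    qed
    then obtain i where i: "\<And>k. d z (from_nat_into D (i k)) < (1/2) ^ k" "\<And>k. from_nat_into D (i k) \<in> M"
      by metis
    \<comment> \<open>The ball of radius \<open>(1/2) ^ k\<close> around the chosen centre contains
      \<open>z\<close>. Any two of these balls are compatible by the triangle inequality through
      \<open>z\<close>.\<close>
    define code where "code k = prod_encode (i k, k)" for k
    have code: "e (code k) = k" "c (code k) \<in> M" "d z (c (code k)) < r (code k)" for k
      using i by (simp_all add: code_def e_def c_def r_def)
    have "y \<in> K (code k)" for k
    proof -
      have "g z \<in> g ` mball (c (code k)) (r (code k))"
        using z code by (simp add: commute)
      moreover have "g ` mball (c (code k)) (r (code k)) \<subseteq> topspace Y"
        using g(1) Z_eq by (auto simp: continuous_map_def)
      ultimately show ?thesis unfolding K_def using z(2) closure_of_subset by blast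
    qed
    moreover have "compat (code k) (code l)" if "k \<noteq> l" for k l
    proof -
      have "d (c (code k)) (c (code l)) \<le> d (c (code k)) z + d z (c (code l))"
        using z code by (intro triangle)
      also have "\<dots> < r (code k) + r (code l)"
        using code(3)[of k] code(3)[of l] by (simp add: commute)
      finally show ?thesis using that by (simp add: compat_def code)
    qed
    ultimately have R: "R y (code k) (code l)" if "k \<noteq> l" for k l
      using that by (simp add: R_def)
    let ?N = "range (\<lambda>k. 4 ^ code k :: nat)"
    have inj: "inj (\<lambda>k. 4 ^ code k :: nat)"
      using code(1) by (metis (mono_tags, lifting) injI one_less_numeral_iff power_inject_exp semiring_norm(76))
    then have "infinite ?N" by (simp add: finite_image_iff)
    moreover have "FS2 ?N \<subseteq> f y"
    proof
      fix s assume "s \<in> FS2 ?N"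
      then obtain k l where kl: "s = 4 ^ code k + 4 ^ code l" "(4::nat) ^ code k \<noteq> 4 ^ code l"
        unfolding FS2_eq by blast
      then have "code k < code l \<or> code l < code k" by (metis linorder_neqE_nat)
      moreover have "k \<noteq> l" using kl(2) by blast
      ultimately show "s \<in> f y"
        unfolding f_def using R[of k l] R[of l k] kl(1) add.commute by blast
    qed
    ultimately show ?thesis unfolding H2_def by blast
  qed
  moreover have "y \<in> B" if y: "y \<in> topspace Y" "f y \<notin> H2" for y
  proof -
    obtain A where "infinite A" "FS2 A \<subseteq> {4 ^ m + 4 ^ n | m n. m < n \<and> R y m n}"
      using y(2) unfolding H2_def f_def by blast
    then obtain N where "infinite N" and R: "\<And>m n. m \<in> N \<Longrightarrow> n \<in> N \<Longrightarrow> m < n \<Longrightarrow> R y m n"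
      using ex_infinite_clique by blast
    have compat: "compat m n" if "m \<in> N" "n \<in> N" "m \<noteq> n" for m n
      using R[of m n] R[of n m] that compat_sym by (cases m n rule: linorder_cases) (auto simp: R_def)
    have K: "y \<in> K n" if "n \<in> N" for n
    proof -
      obtain m where "m \<in> N" "n < m" using \<open>infinite N\<close> by (meson infinite_nat_iff_unbounded)
      then show ?thesis using R[of n m] that by (simp add: R_def)
    qed
    have "inj_on e N" using compat by (auto simp: inj_on_def compat_def)
    then have "infinite (e ` N)" using \<open>infinite N\<close> by (simp add: finite_image_iff)
    then have "\<exists>n\<in>N. k \<le> e n" for k
      unfolding infinite_nat_iff_unbounded_le by (metis imageE)
    \<comment> \<open>\<open>s\<close> need not be injective: one small ball may serve several
      \<open>k\<close>. Hence the Cauchy argument treats \<open>s n = s n'\<close>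
      separately.\<close>
    then obtain s where s: "\<And>k. s k \<in> N" "\<And>k. k \<le> e (s k)" by metis
    have r: "r (s k) \<le> (1/2) ^ j" if "j \<le> k" for j k
      unfolding r_def using s(2)[of k] that by (intro power_decreasing) auto
    define \<sigma> where "\<sigma> k = c (s k)" for k
    have \<sigma>: "\<sigma> k \<in> M" for k
    proof (rule ccontr)
      assume "\<sigma> k \<notin> M"
      \<comment> \<open>A ball with centre outside \<open>M\<close> is empty, so its
        \<open>K\<close> is empty and cannot contain \<open>y\<close>.\<close>
      then have "mball (c (s k)) (r (s k)) = {}" by (simp add: \<sigma>_def mball_def)
      then show False using K[OF s(1)[of k]] by (simp add: K_def)
    qed
    have small: "\<exists>k. (1/2 :: real) ^ k < \<epsilon>" if "\<epsilon> > 0" for \<epsilon>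
      using real_arch_pow_inv[of \<epsilon> "1/2"] that by simp
    have "MCauchy \<sigma>"
      unfolding MCauchy_def
    proof (intro conjI allI impI)
      fix \<epsilon> :: real assume "\<epsilon> > 0"
      then obtain j where j: "(1/2 :: real) ^ j < \<epsilon> / 2" using small[of "\<epsilon>/2"] by auto
      show "\<exists>N. \<forall>n n'. N \<le> n \<longrightarrow> N \<le> n' \<longrightarrow> d (\<sigma> n) (\<sigma> n') < \<epsilon>"
      proof (intro exI[of _ j] allI impI)
        fix n n' assume *: "j \<le> n" "j \<le> n'"
        show "d (\<sigma> n) (\<sigma> n') < \<epsilon>"
        proof (cases "s n = s n'")
          case True then show ?thesis using \<sigma> \<open>\<epsilon> > 0\<close> by (simp add: \<sigma>_def)
        next
          case False
          then have "d (\<sigma> n) (\<sigma> n') < r (s n) + r (s n')"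
            using compat s by (simp add: compat_def \<sigma>_def)
          then show ?thesis using r[OF *(1)] r[OF *(2)] j by simp
        qed
      qed
    qed (use \<sigma> in auto)
    then obtain z where lim: "limitin mtopology \<sigma> z sequentially"
      using \<open>mcomplete\<close> unfolding mcomplete_def by blast
    then have z: "z \<in> M" by (simp add: limitin_metric)
    have contg: "continuous_map mtopology Y.mtopology g" using g(1) Z_eq Y_eq by simp
    then have gM: "g x \<in> M'" if "x \<in> M" for x
      using that by (auto simp: continuous_map_def)
    have yM: "y \<in> M'" using y(1) Y_eq by simp
    \<comment> \<open>Some \<open>x\<close> in a small ball of the clique has \<open>g x\<close>
      close to \<open>y\<close>. That ball lies near \<open>z\<close>, so by continuity
      \<open>g x\<close> is also close to \<open>g z\<close>.\<close>
    have "d' y (g z) < \<epsilon>" if "\<epsilon> > 0" for \<epsilon>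
    proof -
      obtain \<delta> where "\<delta> > 0" and \<delta>: "\<And>x. x \<in> M \<Longrightarrow> d z x < \<delta> \<Longrightarrow> d' (g z) (g x) < \<epsilon> / 2"
        using contg z \<open>\<epsilon> > 0\<close> unfolding metric_continuous_map[OF Y.Metric_space_axioms]
        by (metis half_gt_zero)
      obtain j where j: "(1/2 :: real) ^ j < \<delta> / 2" using small[of "\<delta>/2"] \<open>\<delta> > 0\<close> by auto
      obtain n where n: "\<And>k. n \<le> k \<Longrightarrow> d (\<sigma> k) z < \<delta> / 2"
        using lim \<open>\<delta> > 0\<close> unfolding limitin_metric eventually_sequentially by (meson half_gt_zero)
      let ?k = "max j n"
      have "y \<in> Y.mtopology closure_of (g ` mball (\<sigma> ?k) (r (s ?k)))"
        using K[OF s(1)[of ?k]] by (simp add: K_def \<sigma>_def Y_eq)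
      then obtain x where x: "x \<in> M" "d (\<sigma> ?k) x < r (s ?k)" "d' y (g x) < \<epsilon> / 2"
        unfolding Y.metric_closure_of using half_gt_zero[OF \<open>\<epsilon> > 0\<close>] by fastforce
      have "d z x \<le> d z (\<sigma> ?k) + d (\<sigma> ?k) x" using z \<sigma> x by (intro triangle)
      also have "\<dots> < \<delta>" using n[of ?k] x(2) r[of j ?k] j by (simp add: commute)
      finally have "d' (g z) (g x) < \<epsilon> / 2" using \<delta> x(1) by blast
      moreover have "d' y (g z) \<le> d' y (g x) + d' (g x) (g z)"
        using yM gM z x(1) by (intro Y.triangle) auto
      ultimately show ?thesis using x(3) by (simp add: Y.commute)
    qed
    then have "\<not> 0 < d' y (g z)" by (meson less_irrefl)
    then have "d' y (g z) = 0" using Y.nonneg[of y "g z"] by linarith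
    then have "y = g z" using yM gM z by simp
    then show ?thesis using z g(2) Z_eq by auto
  qed
  moreover have "B \<subseteq> topspace Y"
    using g continuous_map_image_subset_topspace by blast
  ultimately show ?thesis
    unfolding Borel_reducible_def by (intro bexI[of _ f]) auto
qed

theorem theorem2p6:
  shows "Pi11_complete TYPE('y) powerset_topology H2"
  by (simp add: Pi11_complete_def Sigma11_complete_def Polish_space_powerset_topology analytic_not_H2
      analytic_in_Borel_reducible_not_H2)

end
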